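(* Let $F=\sum_{1\le t\le N}F_t$ be a holomorphic correspondence on the Riemann sphere $\widehat{\mathbb{C}}$. Then the topological entropy $h_{\mathrm{top}}(F)$ of $F$ is given by $$h_{\mathrm{top}}(F)=\lim_{\delta\to 0}\ \sup_{\mathcal{U}}\ \lim_{k\to\infty}\frac{1}{k}\log\mathcal{N}_k^F(0,\mathcal{U})=\lim_{\delta\to 0}\ \sup_{\mathcal{U}}\ \lim_{k\to\infty}\frac{1}{k}\log\min\{\#\mathcal{C}:\mathcal{C}\text{ is a finite subcover of }\mathcal{U}_k^F\},$$ where the suprema are taken over all open covers $\mathcal{U}$ of $\widehat{\mathbb{C}}$ with $\mathrm{diam}(\mathcal{U})\le\delta$.
   Context: Holomorphic correspondence: a formal sum $F=\sum_{1\le t\le N}F_t$, where the $F_t$ are irreducible complex-analytic subvarieties (repeated according to multiplicity) of pure dimension $1$ in $\widehat{\mathbb{C}}\times\widehat{\mathbb{C}}$ such that, with $\pi_1,\pi_2$ the two coordinate projections, (1) $\pi_1|_{F_t}$ and $\pi_2|_{F_t}$ are surjective for each $t$; (2) for all $x,y\in\widehat{\mathbb{C}}$ and all $t$, the sets $\pi_2(\pi_1^{-1}(\{x\})\cap F_t)$ and $\pi_1(\pi_2^{-1}(\{y\})\cap F_t)$ are finite. Orbits: for $k\ge 1$, $\mathcal{P}_k^F(\widehat{\mathbb{C}})$ is the set of all permissible forward orbits of length $k$, i.e. all tuples $\mathbf{X}=(z_0,z_1,\dots,z_k;\alpha_1,\dots,\alpha_k)$ with $z_i\in\widehat{\mathbb{C}}$,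 $\alpha_r\in\{1,\dots,N\}$ and $(z_{r-1},z_r)\in F_{\alpha_r}$ for $1\le r\le k$. Put $\Pi_i(\mathbf{X})=z_i$ for $0\le i\le k$ and $\mathrm{proj}_i(\mathbf{X})=\alpha_i$ for $1\le i\le k$. Let $d_{\widehat{\mathbb{C}}}$ be the spherical metric. For $g\in\mathcal{C}(\widehat{\mathbb{C}},\mathbb{R})$ write $E_k(g,\mathbf{X})=\exp\left(\sum_{i=0}^{k-1}g(\Pi_i(\mathbf{X}))\right)$. Separated sets: $\mathcal{Y}\subseteq\mathcal{P}_k^F(\widehat{\mathbb{C}})$ is $(k,\epsilon)$-separated if for every pair of distinct $\mathbf{X},\mathbf{Y}\in\mathcal{Y}$, either $d_{\widehat{\mathbb{C}}}(\Pi_i(\mathbf{X}),\Pi_i(\mathbf{Y}))>\epsilon$ for some $0\le i\le k$, or $\mathrm{proj}_i(\mathbf{X})\ne\mathrm{proj}_i(\mathbf{Y})$ for some $1\le i\le k$. Let $$\mathscr{S}_k^F(g,\epsilon)=\sup\Big\{\sum_{\mathbf{X}\in\mathcal{Y}}E_k(g,\mathbf{X}):\mathcal{Y}\text{ is }(k,\epsilon)\text{-separated}\Big\},\qquad \mathrm{Pr}(g,F)=\lim_{\epsilon\to 0}\limsup_{k\to\infty}\frac{1}{k}\log\mathscr{S}_k^F(g,\epsilon).$$ The topological entropy of $F$ is $h_{\mathrm{top}}(F)=\mathrm{Pr}(0,F)$, where $0$ is the zero function. Open covers: for an open cover $\mathcal{U}$ of $\widehat{\mathbb{C}}$, let $\mathcal{U}_k^F=\bigvee_{i=0}^{k-1}\{\Pi_i^{-1}(\mathcal{U})\cap\mathrm{proj}_{i+1}^{-1}\{j\}:1\le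 j\le N\}\bigvee\Pi_k^{-1}(\mathcal{U})$, i.e. the open cover of $\mathcal{P}_k^F(\widehat{\mathbb{C}})$ by all sets $\bigcap_{i=0}^{k}\Pi_i^{-1}(U_i)\cap\bigcap_{i=1}^{k}\mathrm{proj}_i^{-1}\{j_i\}$ with $U_i\in\mathcal{U}$, $j_i\in\{1,\dots,N\}$ (empty members of a subcover may be discarded). Define $$\mathcal{N}_k^F(g,\mathcal{U})=\inf_{\mathcal{C}}\sum_{\gamma\in\mathcal{C}}\sup_{\mathbf{X}\in\gamma}E_k(g,\mathbf{X}),$$ where $\mathcal{C}$ ranges over finite subcovers of $\mathcal{U}_k^F$. $\mathrm{diam}(\mathcal{U})=\sup_{U\in\mathcal{U}}\mathrm{diam}(U)$ with respect to $d_{\widehat{\mathbb{C}}}$. *)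

theory Defs
  imports "HOL-Analysis.Analysis"
begin

section \<open>The Riemann sphere with its spherical metric\<close>

datatype riemann_sphere = Pt complex | Infty

text \<open>Inverse stereographic projection onto the unit sphere of \<open>\<complex> \<times> \<real> = \<real>\<^sup>3\<close>.\<close>

fun stereo :: "riemann_sphere \<Rightarrow> complex \<times> real" where
  "stereo (Pt z) = ((2 / (1 + (cmod z)\<^sup>2)) *\<^sub>R z, ((cmod z)\<^sup>2 - 1) / ((cmod z)\<^sup>2 + 1))"
| "stereo Infty = (0, 1)"

lemma norm_stereo: "stereo x \<bullet> stereo x = 1"
proof (cases x)
  case (Pt z)
  define r where "r = (cmod z)\<^sup>2"
  have r: "0 \<le> r" "z \<bullet> z = r" by (simp_all add: r_def dot_square_norm)
  have "stereo x \<bullet> stereo x = (2 / (1 + r))\<^sup>2 * r + ((r - 1) / (r + 1))\<^sup>2"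
    using r(2) by (simp add: Pt inner_prod_def r_def power2_eq_square)
  also have "\<dots> = (4 * r + (r - 1)\<^sup>2) / (1 + r)\<^sup>2"
    by (simp add: power_divide add_divide_distrib add.commute)
  also have "4 * r + (r - 1)\<^sup>2 = (1 + r)\<^sup>2" by (simp add: power2_eq_square algebra_simps)
  finally show ?thesis using r(1) by simp
qed (simp add: inner_prod_def)

lemma norm_stereo' [simp]: "norm (stereo x) = 1"
  by (simp add: norm_eq_sqrt_inner norm_stereo)

lemma inj_stereo: "stereo x = stereo y \<Longrightarrow> x = y"
proof -
  have *: "(r - 1) / (r + 1) = 1 - 2 / (1 + r)" if "0 \<le> r" for r :: real
    using that by (simp add: field_simps)
  have ne: "((cmod z)\<^sup>2 - 1) / ((cmod z)\<^sup>2 + 1) \<noteq> 1" for z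
    by (simp add: divide_eq_eq)
  have inj: "z = w" if "stereo (Pt z) = stereo (Pt w)" for z w
  proof -
    have "2 / (1 + (cmod z)\<^sup>2) = 2 / (1 + (cmod w)\<^sup>2)"
      using that by (simp add: *)
    moreover have "2 / (1 + (cmod w)\<^sup>2) \<noteq> 0" by (smt (verit) divide_eq_0_iff zero_le_power2)
    moreover have "(2 / (1 + (cmod z)\<^sup>2)) *\<^sub>R z = (2 / (1 + (cmod w)\<^sup>2)) *\<^sub>R w"
      using that by simp
    ultimately show ?thesis by (metis scaleR_left_imp_eq)
  qed
  have Infty: "stereo (Pt z) \<noteq> stereo Infty" for z
    using ne[of z] by simp
  assume "stereo x = stereo y"
  then show "x = y"
    using inj Infty by (metis riemann_sphere.exhaust)
qed

lemma arccos_triangle: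
  fixes a b c :: "'a::real_inner"
  assumes [simp]: "norm a = 1" "norm b = 1" "norm c = 1"
  shows "arccos (a \<bullet> c) \<le> arccos (a \<bullet> b) + arccos (b \<bullet> c)"
proof -
  have bd: "\<bar>x \<bullet> y\<bar> \<le> 1" if "norm x = 1" "norm y = 1" for x y :: 'a
    using Cauchy_Schwarz_ineq2[of x y] that by simp
  have sq: "x \<bullet> x = 1" if "norm x = 1" for x :: 'a
    using that by (simp add: norm_eq_1)
  define p q where "p = arccos (a \<bullet> b)" and "q = arccos (b \<bullet> c)"
  have p: "cos p = a \<bullet> b" "0 \<le> p" "p \<le> pi" and q: "cos q = b \<bullet> c" "0 \<le> q" "q \<le> pi"
    using bd[of a b] bd[of b c] unfolding p_def q_def
    by (simp_all add: cos_arccos_abs arccos_lbound arccos_ubound abs_le_iff)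
  define u v where "u = a - (a \<bullet> b) *\<^sub>R b" and "v = c - (b \<bullet> c) *\<^sub>R b"
  have uu: "u \<bullet> u = (sin p)\<^sup>2"
    unfolding sin_squared_eq using sq[of a] sq[of b]
    by (simp add: u_def inner_diff p inner_commute power2_eq_square)
  have vv: "v \<bullet> v = (sin q)\<^sup>2"
    unfolding sin_squared_eq using sq[of c] sq[of b]
    by (simp add: v_def inner_diff q inner_commute power2_eq_square)
  have "norm u = sin p" "norm v = sin q"
    using uu vv p q by (simp_all add: norm_eq_sqrt_inner sin_ge_zero)
  then have "- (sin p * sin q) \<le> u \<bullet> v"
    using Cauchy_Schwarz_ineq2[of u v] by simp
  moreover have "u \<bullet> v = a \<bullet> c - (a \<bullet> b) * (b \<bullet> c)"
    using sq[of b] by (simp add: u_def v_def inner_diff inner_commute)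
  ultimately have ge: "cos (p + q) \<le> a \<bullet> c" by (simp add: cos_add p q)
  show ?thesis
  proof (cases "p + q \<le> pi")
    case True
    have "arccos (a \<bullet> c) \<le> arccos (cos (p + q))"
      using ge bd[of a c] cos_ge_minus_one[of "p + q"] by (intro arccos_le_arccos) auto
    then show ?thesis using True p q by (simp add: arccos_cos p_def q_def)
  next
    case False
    then show ?thesis using arccos_ubound[of "a \<bullet> c"] bd[of a c]
      by (simp add: p_def q_def abs_le_iff)
  qed
qed

text \<open>The spherical metric is the great-circle distance on the unit sphere, i.e. the distance
  function of the Riemannian metric \<open>2 |dz| / (1 + |z|\<^sup>2)\<close>.\<close>

instantiation riemann_sphere :: metric_space
begin

definition dist_riemann_sphere :: "riemann_sphere \<Rightarrow> riemann_sphere \<Rightarrow> real" where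
  "dist_riemann_sphere x y = arccos (stereo x \<bullet> stereo y)"

definition uniformity_riemann_sphere :: "(riemann_sphere \<times> riemann_sphere) filter" where
  "uniformity_riemann_sphere = (INF e\<in>{0<..}. principal {(x, y). dist x y < e})"

definition open_riemann_sphere :: "riemann_sphere set \<Rightarrow> bool" where
  "open_riemann_sphere U \<longleftrightarrow> (\<forall>x\<in>U. eventually (\<lambda>(x', y). x' = x \<longrightarrow> y \<in> U) uniformity)"

instance
proof
  fix x y z :: riemann_sphere
  have bd: "\<bar>stereo x \<bullet> stereo y\<bar> \<le> 1"
    using Cauchy_Schwarz_ineq2[of "stereo x" "stereo y"] by simp
  show "dist x y = 0 \<longleftrightarrow> x = y"
  proof
    assume "dist x y = 0"
    then have "stereo x \<bullet> stereo y = 1"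
      using cos_arccos_abs[OF bd] by (simp add: dist_riemann_sphere_def)
    then have "(stereo x - stereo y) \<bullet> (stereo x - stereo y) = 0"
      by (simp add: inner_diff norm_stereo inner_commute)
    then show "x = y" by (simp add: inj_stereo)
  qed (simp add: dist_riemann_sphere_def norm_stereo)
  show "dist x y \<le> dist x z + dist y z"
    using arccos_triangle[of "stereo x" "stereo z" "stereo y"]
    by (simp add: dist_riemann_sphere_def inner_commute)
qed (simp_all only: uniformity_riemann_sphere_def open_riemann_sphere_def)

end

section \<open>Analytic subsets of the square of the sphere\<close>

definition holomorphic2_on :: "(complex \<times> complex \<Rightarrow> complex) \<Rightarrow> (complex \<times> complex) set \<Rightarrow> bool" where
  "holomorphic2_on f U \<longleftrightarrow>
     (\<forall>p\<in>U. \<exists>a b. (f has_derivative (\<lambda>(u, v). a * u + b * v)) (at p))"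

definition analytic_subset_C2 :: "(complex \<times> complex) set \<Rightarrow> bool" where
  "analytic_subset_C2 S \<longleftrightarrow>
     (\<forall>p. \<exists>U (n::nat) f. open U \<and> p \<in> U \<and> (\<forall>i<n. holomorphic2_on (f i) U) \<and>
        S \<inter> U = {q\<in>U. \<forall>i<n. f i q = 0})"

text \<open>Near \<open>p\<close>, the set is a complex submanifold of dimension \<open>d\<close>: the common zero set of
  \<open>2 - d\<close> holomorphic functions whose differentials at \<open>p\<close> are linearly independent.\<close>

definition regular_point_C2 :: "nat \<Rightarrow> (complex \<times> complex) set \<Rightarrow> complex \<times> complex \<Rightarrow> bool" where
  "regular_point_C2 d S p \<longleftrightarrow> d \<le> 2 \<and> p \<in> S \<and>
     (\<exists>U f a b. open U \<and> p \<in> U \<and>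
        (\<forall>i<2 - d. holomorphic2_on (f i) U \<and>
           (f i has_derivative (\<lambda>(u, v). a i * u + b i * v)) (at p)) \<and>
        S \<inter> U = {q\<in>U. \<forall>i<2 - d. f i q = 0} \<and>
        (\<forall>c. (\<Sum>i<2 - d. c i * a i) = 0 \<and> (\<Sum>i<2 - d. c i * b i) = 0 \<longrightarrow> (\<forall>i<2 - d. c i = 0)))"

text \<open>The inverses of the two standard charts \<open>z\<close> and \<open>1/z\<close>; both are defined on all of \<open>\<complex>\<close>.\<close>

definition sphere_params :: "(complex \<Rightarrow> riemann_sphere) set" where
  "sphere_params = {Pt, \<lambda>w. if w = 0 then Infty else Pt (1 / w)}"

definition analytic_subset :: "(riemann_sphere \<times> riemann_sphere) set \<Rightarrow> bool" where
  "analytic_subset A \<longleftrightarrow>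
     (\<forall>\<phi>\<in>sphere_params. \<forall>\<psi>\<in>sphere_params. analytic_subset_C2 (map_prod \<phi> \<psi> -` A))"

definition regular_point ::
  "nat \<Rightarrow> (riemann_sphere \<times> riemann_sphere) set \<Rightarrow> riemann_sphere \<times> riemann_sphere \<Rightarrow> bool" where
  "regular_point d A p \<longleftrightarrow>
     (\<exists>\<phi>\<in>sphere_params. \<exists>\<psi>\<in>sphere_params. \<exists>q.
        p = map_prod \<phi> \<psi> q \<and> regular_point_C2 d (map_prod \<phi> \<psi> -` A) q)"

text \<open>The dimension at \<open>p\<close> is the limit superior of the dimensions at the regular points
  tending to \<open>p\<close>.\<close>

definition local_dim ::
  "(riemann_sphere \<times> riemann_sphere) set \<Rightarrow> riemann_sphere \<times> riemann_sphere \<Rightarrow> nat" where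
  "local_dim A p = Max {d. d \<le> 2 \<and> p \<in> closure {q. regular_point d A q}}"

definition pure_dimensional :: "nat \<Rightarrow> (riemann_sphere \<times> riemann_sphere) set \<Rightarrow> bool" where
  "pure_dimensional d A \<longleftrightarrow> (\<forall>p\<in>A. local_dim A p = d)"

definition irreducible_analytic :: "(riemann_sphere \<times> riemann_sphere) set \<Rightarrow> bool" where
  "irreducible_analytic A \<longleftrightarrow> analytic_subset A \<and> A \<noteq> {} \<and>
     (\<forall>B C. analytic_subset B \<and> analytic_subset C \<and> A = B \<union> C \<longrightarrow> A = B \<or> A = C)"

section \<open>Holomorphic correspondences and their orbits\<close>

text \<open>The formal sum \<open>F\<^sub>1 + \<dots> + F\<^sub>N\<close> is represented by \<open>N\<close> and the family \<open>F\<close>, of which only the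
  values at \<open>1, \<dots>, N\<close> matter; repetitions account for multiplicities.\<close>

definition holomorphic_correspondence ::
  "nat \<Rightarrow> (nat \<Rightarrow> (riemann_sphere \<times> riemann_sphere) set) \<Rightarrow> bool" where
  "holomorphic_correspondence N F \<longleftrightarrow> 1 \<le> N \<and>
     (\<forall>t\<in>{1..N}. irreducible_analytic (F t) \<and> pure_dimensional 1 (F t) \<and>
        fst ` F t = UNIV \<and> snd ` F t = UNIV \<and>
        (\<forall>x. finite (snd ` (fst -` {x} \<inter> F t))) \<and>
        (\<forall>y. finite (fst ` (snd -` {y} \<inter> F t))))"

type_synonym orbit = "(nat \<Rightarrow> riemann_sphere) \<times> (nat \<Rightarrow> nat)"

text \<open>Tuples \<open>(z\<^sub>0, \<dots>, z\<^sub>k; \<alpha>\<^sub>1, \<dots>, \<alpha>\<^sub>k)\<close> are pairs of extensional functions on \<open>{0..k}\<close>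
  and \<open>{1..k}\<close>.\<close>

definition orbits ::
  "nat \<Rightarrow> (nat \<Rightarrow> (riemann_sphere \<times> riemann_sphere) set) \<Rightarrow> nat \<Rightarrow> orbit set" where
  "orbits N F k = {(z, \<alpha>). z \<in> {0..k} \<rightarrow>\<^sub>E UNIV \<and> \<alpha> \<in> {1..k} \<rightarrow>\<^sub>E {1..N} \<and>
     (\<forall>r\<in>{1..k}. (z (r - 1), z r) \<in> F (\<alpha> r))}"

definition orbit_point :: "nat \<Rightarrow> orbit \<Rightarrow> riemann_sphere" where
  "orbit_point i X = fst X i"

definition orbit_index :: "nat \<Rightarrow> orbit \<Rightarrow> nat" where
  "orbit_index i X = snd X i"

definition orbit_weight :: "nat \<Rightarrow> (riemann_sphere \<Rightarrow> real) \<Rightarrow> orbit \<Rightarrow> real" where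
  "orbit_weight k g X = exp (\<Sum>i<k. g (orbit_point i X))"

section \<open>Pressure and entropy\<close>

definition log_ennreal :: "ennreal \<Rightarrow> ereal" where
  "log_ennreal x = (if x = 0 then -\<infinity> else if x = \<infinity> then \<infinity> else ereal (ln (enn2real x)))"

definition separated ::
  "nat \<Rightarrow> (nat \<Rightarrow> (riemann_sphere \<times> riemann_sphere) set) \<Rightarrow> nat \<Rightarrow> real \<Rightarrow> orbit set \<Rightarrow> bool" where
  "separated N F k \<epsilon> Y \<longleftrightarrow> Y \<subseteq> orbits N F k \<and>
     (\<forall>X\<in>Y. \<forall>X'\<in>Y. X \<noteq> X' \<longrightarrow>
        (\<exists>i\<in>{0..k}. dist (orbit_point i X) (orbit_point i X') > \<epsilon>) \<or>
        (\<exists>i\<in>{1..k}. orbit_index i X \<noteq> orbit_index i X'))"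

definition separated_sum ::
  "nat \<Rightarrow> (nat \<Rightarrow> (riemann_sphere \<times> riemann_sphere) set) \<Rightarrow> nat \<Rightarrow> (riemann_sphere \<Rightarrow> real) \<Rightarrow>
   real \<Rightarrow> ennreal" where
  "separated_sum N F k g \<epsilon> =
     (SUP Y\<in>{Y. separated N F k \<epsilon> Y}. \<Sum>\<^sub>\<infinity>X\<in>Y. ennreal (orbit_weight k g X))"

definition pressure ::
  "nat \<Rightarrow> (nat \<Rightarrow> (riemann_sphere \<times> riemann_sphere) set) \<Rightarrow> (riemann_sphere \<Rightarrow> real) \<Rightarrow> ereal" where
  "pressure N F g = Lim (at_right 0)
     (\<lambda>\<epsilon>. limsup (\<lambda>k. ereal (1 / real k) * log_ennreal (separated_sum N F k g \<epsilon>)))"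

definition topological_entropy ::
  "nat \<Rightarrow> (nat \<Rightarrow> (riemann_sphere \<times> riemann_sphere) set) \<Rightarrow> ereal" where
  "topological_entropy N F = pressure N F (\<lambda>_. 0)"

section \<open>Open covers\<close>

definition open_cover :: "riemann_sphere set set \<Rightarrow> bool" where
  "open_cover \<U> \<longleftrightarrow> (\<forall>U\<in>\<U>. open U) \<and> \<Union>\<U> = UNIV"

definition cover_diameter :: "riemann_sphere set set \<Rightarrow> real" where
  "cover_diameter \<U> = (SUP U\<in>\<U>. diameter U)"

definition orbit_cover ::
  "nat \<Rightarrow> (nat \<Rightarrow> (riemann_sphere \<times> riemann_sphere) set) \<Rightarrow> nat \<Rightarrow> riemann_sphere set set \<Rightarrow>
   orbit set set" where
  "orbit_cover N F k \<U> =
     {{X \<in> orbits N F k. (\<forall>i\<in>{0..k}. orbit_point i X \<in> U i) \<and> (\<forall>i\<in>{1..k}. orbit_index i X = j i)}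
       | U j. (\<forall>i\<in>{0..k}. U i \<in> \<U>) \<and> (\<forall>i\<in>{1..k}. j i \<in> {1..N})}"

definition finite_subcovers ::
  "nat \<Rightarrow> (nat \<Rightarrow> (riemann_sphere \<times> riemann_sphere) set) \<Rightarrow> nat \<Rightarrow> riemann_sphere set set \<Rightarrow>
   orbit set set set" where
  "finite_subcovers N F k \<U> = {C. finite C \<and> C \<subseteq> orbit_cover N F k \<U> \<and> \<Union>C = orbits N F k}"

text \<open>In \<open>ennreal\<close> the supremum over an empty \<open>\<gamma>\<close> is \<open>0\<close>, so empty members of a subcover do not
  contribute.\<close>

definition cover_sum ::
  "nat \<Rightarrow> (nat \<Rightarrow> (riemann_sphere \<times> riemann_sphere) set) \<Rightarrow> nat \<Rightarrow> (riemann_sphere \<Rightarrow> real) \<Rightarrow>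
   riemann_sphere set set \<Rightarrow> ennreal" where
  "cover_sum N F k g \<U> =
     (INF C\<in>finite_subcovers N F k \<U>. \<Sum>\<gamma>\<in>C. SUP X\<in>\<gamma>. ennreal (orbit_weight k g X))"

definition min_subcover_card ::
  "nat \<Rightarrow> (nat \<Rightarrow> (riemann_sphere \<times> riemann_sphere) set) \<Rightarrow> nat \<Rightarrow> riemann_sphere set set \<Rightarrow> nat" where
  "min_subcover_card N F k \<U> = (LEAST n. \<exists>C\<in>finite_subcovers N F k \<U>. card C = n)"

section \<open>Existence of the limit defining the pressure\<close>

lemma log_ennreal_mono: "x \<le> y \<Longrightarrow> log_ennreal x \<le> log_ennreal y"
  by (cases x; cases y) (auto simp: log_ennreal_def top_unique ennreal_eq_0_iff)

lemma separated_sum_antimono: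
  assumes "\<epsilon> \<le> \<epsilon>'"
  shows "separated_sum N F k g \<epsilon>' \<le> separated_sum N F k g \<epsilon>"
  unfolding separated_sum_def
proof (rule SUP_subset_mono)
  show "{Y. separated N F k \<epsilon>' Y} \<subseteq> {Y. separated N F k \<epsilon> Y}"
    using assms unfolding separated_def by (blast intro: order.strict_trans1)
qed simp

lemma pressure_limit:
  "((\<lambda>\<epsilon>. limsup (\<lambda>k. ereal (1 / real k) * log_ennreal (separated_sum N F k g \<epsilon>)))
     \<longlongrightarrow> pressure N F g) (at_right 0)"
proof -
  define f where
    "f \<epsilon> = limsup (\<lambda>k. ereal (1 / real k) * log_ennreal (separated_sum N F k g \<epsilon>))" for \<epsilon>
  have anti: "f \<epsilon>' \<le> f \<epsilon>" if "\<epsilon> \<le> \<epsilon>'" for \<epsilon> \<epsilon>'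
    unfolding f_def using that
    by (intro Limsup_mono always_eventually allI ereal_mult_left_mono log_ennreal_mono
        separated_sum_antimono) auto
  have "(f \<longlongrightarrow> (SUP \<epsilon>\<in>{0<..}. f \<epsilon>)) (at_right 0)"
  proof (rule increasing_tendsto)
    show "\<forall>\<^sub>F \<epsilon> in at_right 0. f \<epsilon> \<le> (SUP \<epsilon>\<in>{0<..}. f \<epsilon>)"
      by (auto simp: eventually_at_filter intro!: always_eventually SUP_upper)
  next
    fix x assume "x < (SUP \<epsilon>\<in>{0<..}. f \<epsilon>)"
    then obtain e where "0 < e" "x < f e" by (auto simp: less_SUP_iff)
    then show "\<forall>\<^sub>F \<epsilon> in at_right 0. x < f \<epsilon>"
      unfolding eventually_at_right_field
      by (metis anti less_imp_le order.strict_trans2)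
  qed
  then show ?thesis
    unfolding f_def pressure_def by (simp add: tendsto_Lim)
qed

end

theory Submission
  imports Defs
begin

text \<open>Write \<open>n k \<U>\<close> for the least number of members of a subcover of the cover that \<open>\<U>\<close> induces on
  the orbits of length \<open>k\<close>. For the zero function every weight is \<open>1\<close>, so \<open>cover_sum\<close> is just
  \<open>n k \<U>\<close> (\<open>cover_sum_zero\<close>) and the two formulas for the entropy are the same formula.

  The limit over \<open>k\<close> exists because \<open>n (k + l) \<U> \<le> n k \<U> * n l \<U>\<close>: an orbit of length \<open>k + l\<close>
  is cut at time \<open>k\<close> and both pieces are located in a minimal subcover. Fekete's lemma then applies
  to \<open>ln (n k \<U>)\<close>.

  The comparison with the entropy is Bowen's. If the members of \<open>\<U>\<close> have diameter at most \<open>\<epsilon>\<close>,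
  two orbits in one member of the induced cover are never \<open>\<epsilon>\<close>-separated, so an \<open>\<epsilon>\<close>-separated set
  has at most \<open>n k \<U>\<close> elements. If conversely every closed \<open>\<epsilon>\<close>-ball lies in a member of \<open>\<U>\<close>, then
  a largest \<open>\<epsilon>\<close>-separated set yields a subcover with as many members: by maximality each orbit is
  \<open>\<epsilon>\<close>-close to one in the set, along the same indices. Such an \<open>\<epsilon>\<close> exists for every open
  cover since the sphere is compact. Hence, with \<open>s \<epsilon>\<close> the growth rate of \<open>\<epsilon>\<close>-separated sets,
  the supremum over the covers of diameter at most \<open>\<delta>\<close> lies between \<open>s \<delta>\<close> and the entropy, and
  \<open>s \<delta>\<close> tends to the entropy as \<open>\<delta>\<close> tends to \<open>0\<close>.\<close>

section \<open>Compactness of the sphere\<close>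

lemma stereo_surj:
  assumes "norm p = 1"
  obtains x where "stereo x = p"
proof -
  obtain w t where p: "p = (w, t)" by (cases p)
  have wt: "(cmod w)\<^sup>2 + t\<^sup>2 = 1"
    using assms by (simp add: p norm_Pair)
  show thesis
  proof (cases "t = 1")
    case True
    then show ?thesis using wt that[of Infty] by (simp add: p)
  next
    case False
    have "t\<^sup>2 \<le> 1" using wt by (smt (verit) zero_le_power2)
    then have t: "t < 1" using False by (simp add: power2_le_iff_abs_le abs_square_le_1)
    \<comment> \<open>The preimage is \<open>w / (1 - t)\<close>, and \<open>r\<close> is its squared modulus.\<close>
    define r where "r = (1 + t) / (1 - t)"
    have "(cmod (w /\<^sub>R (1 - t)))\<^sup>2 = (1 - t\<^sup>2) / (1 - t)\<^sup>2"
      using wt t by (simp add: power_divide divide_inverse[symmetric] power_mult_distrib power_inverse field_simps)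
    also have "\<dots> = r"
      using t by (simp add: r_def divide_simps) (simp add: power2_eq_square algebra_simps)
    finally have r: "(cmod (w /\<^sub>R (1 - t)))\<^sup>2 = r" .
    have "2 / (1 + r) = 1 - t" "(r - 1) / (r + 1) = t"
      using t by (simp_all add: r_def field_simps)
    then have "stereo (Pt (w /\<^sub>R (1 - t))) = p"
      using t by (simp only: stereo.simps r) (simp add: p)
    then show ?thesis by (rule that)
  qed
qed

text \<open>Stereographic projection identifies the sphere with a compact subset of Euclidean space,
  and a limit there is a limit for the great-circle distance because \<open>arccos\<close> is continuous
  up to the boundary point \<open>1\<close>.\<close>

lemma compact_riemann_sphere: "compact (UNIV :: riemann_sphere set)"
  unfolding compact_eq_seq_compact_metric seq_compact_def
proof (intro allI impI)
  fix f :: "nat \<Rightarrow> riemann_sphere"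
  have "compact (sphere (0::complex \<times> real) 1)" by simp
  then have "seq_compact (sphere (0::complex \<times> real) 1)"
    by (simp only: compact_eq_seq_compact_metric)
  moreover have "\<forall>n. stereo (f n) \<in> sphere 0 1" by simp
  ultimately obtain p s where p: "p \<in> sphere 0 1" and s: "strict_mono s"
    and lim: "(\<lambda>n. stereo (f (s n))) \<longlonglongrightarrow> p"
    using seq_compactE[of "sphere 0 1" "\<lambda>n. stereo (f n)"] unfolding o_def by blast
  from p obtain x where x: "stereo x = p" using stereo_surj[of p] by auto
  have "(\<lambda>n. arccos (stereo (f (s n)) \<bullet> p)) \<longlonglongrightarrow> arccos (p \<bullet> p)"
  proof (rule continuous_on_tendsto_compose[OF continuous_on_arccos'])
    show "(\<lambda>n. stereo (f (s n)) \<bullet> p) \<longlonglongrightarrow> p \<bullet> p"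
      by (intro tendsto_intros lim)
    show "p \<bullet> p \<in> {-1..1}" using norm_stereo[of x] x by simp
    have "\<bar>stereo (f (s n)) \<bullet> p\<bar> \<le> 1" for n
      using Cauchy_Schwarz_ineq2[of "stereo (f (s n))" p] p by simp
    then show "\<forall>\<^sub>F n in sequentially. stereo (f (s n)) \<bullet> p \<in> {-1..1}"
      by (intro always_eventually allI) (simp add: abs_le_iff minus_le_iff)
  qed
  then have "(\<lambda>n. dist (f (s n)) x) \<longlonglongrightarrow> 0"
    using norm_stereo[of x] x by (simp add: dist_riemann_sphere_def)
  then have "(f \<circ> s) \<longlonglongrightarrow> x"
    by (simp add: tendsto_dist_iff[of _ x] o_def)
  with s show "\<exists>l\<in>UNIV. \<exists>r. strict_mono r \<and> (f \<circ> r) \<longlonglongrightarrow> l" by blast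
qed

lemma bounded_riemann_sphere: "bounded (S :: riemann_sphere set)"
  using bounded_subset[OF compact_imp_bounded[OF compact_riemann_sphere]] by blast

lemma dist_le_cover_diameter:
  assumes "U \<in> \<U>" "x \<in> U" "y \<in> U"
  shows "dist x y \<le> cover_diameter \<U>"
proof -
  have "dist x y \<le> diameter U"
    using assms by (intro diameter_bounded_bound bounded_riemann_sphere)
  also have "\<dots> \<le> cover_diameter \<U>"
    unfolding cover_diameter_def
  proof (rule cSUP_upper[OF assms(1)])
    show "bdd_above (diameter ` \<U>)"
      by (rule bdd_aboveI[of _ "diameter (UNIV :: riemann_sphere set)"])
        (auto intro!: diameter_subset bounded_riemann_sphere)
  qed
  finally show ?thesis .
qed

lemma ex_fine_open_cover:
  assumes "0 < \<delta>"
  shows "\<exists>\<U>. open_cover \<U> \<and> cover_diameter \<U> \<le> \<delta>"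
proof (intro exI conjI)
  let ?U = "range (\<lambda>x :: riemann_sphere. ball x (\<delta> / 2))"
  show "open_cover ?U"
    using assms by (auto simp: open_cover_def)
  have "diameter (ball x (\<delta> / 2)) \<le> \<delta>" for x :: riemann_sphere
  proof -
    have "dist y z \<le> \<delta>" if "y \<in> ball x (\<delta> / 2)" "z \<in> ball x (\<delta> / 2)" for y z
      using that dist_triangle[of y z x] by (simp add: dist_commute)
    moreover have "ball x (\<delta> / 2) \<noteq> {}" using assms by simp
    ultimately show ?thesis
      by (auto simp: diameter_def intro!: cSUP_least)
  qed
  then show "cover_diameter ?U \<le> \<delta>"
    unfolding cover_diameter_def by (intro cSUP_least) auto
qed

section \<open>Subadditive sequences\<close>

lemma subadditive_mult_add_le:
  fixes a :: "nat \<Rightarrow> real"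
  assumes "\<And>m n. a (m + n) \<le> a m + a n"
  shows "a (q * m + r) \<le> real q * a m + a r"
proof (induction q)
  case (Suc q)
  have "a (Suc q * m + r) = a (m + (q * m + r))" by (simp add: add.assoc)
  also have "\<dots> \<le> a m + (real q * a m + a r)" using assms Suc.IH by (smt (verit))
  finally show ?case by (simp add: algebra_simps)
qed simp

text \<open>Fekete's lemma. Writing \<open>n = q * m + r\<close> with \<open>r < m\<close>, subadditivity bounds \<open>a n / n\<close> by
  \<open>a m / m + O(1 / n)\<close>, for each fixed \<open>m\<close>; hence the limit superior is at most the infimum of
  the quotients.\<close>

lemma subadditive_convergent:
  fixes a :: "nat \<Rightarrow> real"
  assumes sub: "\<And>m n. a (m + n) \<le> a m + a n" and nonneg: "\<And>n. 0 \<le> a n"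
  shows "convergent (\<lambda>n. a n / real n)"
proof -
  define L where "L = (INF n\<in>{1..}. a n / real n)"
  have bdd: "bdd_below ((\<lambda>n. a n / real n) ` {1..})"
    by (rule bdd_belowI[of _ 0]) (auto simp: nonneg)
  have "(\<lambda>n. a n / real n) \<longlonglongrightarrow> L"
  proof (rule order_tendstoI)
    fix y assume "y < L"
    have "L \<le> a n / real n" if "1 \<le> n" for n
      unfolding L_def using that by (intro cINF_lower[OF bdd]) simp
    then have "y < a n / real n" if "1 \<le> n" for n
      using \<open>y < L\<close> that order.strict_trans2 by blast
    then show "\<forall>\<^sub>F n in sequentially. y < a n / real n"
      by (rule eventually_sequentiallyI)
  next
    fix y assume "L < y"
    then obtain m where m: "1 \<le> m" "a m / real m < y"
      unfolding L_def by (subst (asm) cINF_less_iff[OF _ bdd]) auto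
    define B where "B = Max (a ` {..<m})"
    have le: "a n / real n \<le> a m / real m + B / real n" if "1 \<le> n" for n
    proof -
      have "a n \<le> real (n div m) * a m + a (n mod m)"
        using subadditive_mult_add_le[of a "n div m" m "n mod m"] sub by simp
      also have "\<dots> \<le> real n / real m * a m + B"
      proof (intro add_mono mult_right_mono nonneg)
        show "real (n div m) \<le> real n / real m"
          using m(1) by (simp add: le_divide_eq flip: of_nat_mult)
        show "a (n mod m) \<le> B"
          unfolding B_def using m(1) by (intro Max_ge) auto
      qed
      finally have "a n / real n \<le> (real n / real m * a m + B) / real n"
        by (simp add: divide_right_mono)
      also have "\<dots> = a m / real m + B / real n"
        using that by (simp add: add_divide_distrib)
      finally show ?thesis .
    qed
    have "(\<lambda>n. a m / real m + B / real n) \<longlonglongrightarrow> a m / real m + 0"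
      by (intro tendsto_intros lim_const_over_n)
    then have "\<forall>\<^sub>F n in sequentially. a m / real m + B / real n < y"
      using m(2) by (intro order_tendstoD(2)) auto
    then show "\<forall>\<^sub>F n in sequentially. a n / real n < y"
      using eventually_ge_at_top[of 1]
      by eventually_elim (use le in \<open>auto intro: order.strict_trans1\<close>)
  qed
  then show ?thesis by (auto simp: convergent_def)
qed

section \<open>Orbits and cells\<close>

text \<open>Existence of orbits makes all subcover numbers positive, so that their logarithms are
  meaningful. The orbit comes from iterating a selection of the first summand.\<close>

lemma orbits_nonempty:
  assumes "1 \<le> N" and surj: "fst ` F 1 = (UNIV :: riemann_sphere set)"
  shows "orbits N F k \<noteq> {}"
proof -
  have "\<exists>y. (x, y) \<in> F 1" for x
  proof -
    have "x \<in> fst ` F 1" unfolding surj by (rule UNIV_I)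
    then show ?thesis by force
  qed
  then obtain f where f: "\<And>x. (x, f x) \<in> F 1" by metis
  define z where "z i = (f ^^ i) Infty" for i
  have step: "(z (r - 1), z r) \<in> F 1" if "r \<in> {1..k}" for r
    using f[of "z (r - 1)"] that by (cases r) (auto simp: z_def)
  have "(restrict z {0..k}, restrict (\<lambda>_. 1) {1..k}) \<in> orbits N F k"
    using assms(1) step by (auto simp: orbits_def)
  then show ?thesis by blast
qed

definition orbit_cell ::
  "nat \<Rightarrow> (nat \<Rightarrow> (riemann_sphere \<times> riemann_sphere) set) \<Rightarrow> nat \<Rightarrow>
   (nat \<Rightarrow> riemann_sphere set) \<Rightarrow> (nat \<Rightarrow> nat) \<Rightarrow> orbit set" where
  "orbit_cell N F k U j = {X \<in> orbits N F k.
     (\<forall>i\<in>{0..k}. orbit_point i X \<in> U i) \<and> (\<forall>i\<in>{1..k}. orbit_index i X = j i)}"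

lemma orbit_cover_eq_cells:
  "orbit_cover N F k \<U> =
     {orbit_cell N F k U j | U j. (\<forall>i\<in>{0..k}. U i \<in> \<U>) \<and> (\<forall>i\<in>{1..k}. j i \<in> {1..N})}"
  unfolding orbit_cover_def orbit_cell_def ..

lemma orbit_index_mem:
  assumes "X \<in> orbits N F k" "i \<in> {1..k}"
  shows "orbit_index i X \<in> {1..N}"
  using assms by (auto simp: orbits_def orbit_index_def PiE_iff)

text \<open>Minimal subcovers are estimated through families indexed by an arbitrary finite set, such
  as pairs of cells or separated orbits; repetitions in the family only help.\<close>

lemma min_subcover_card_le:
  assumes "finite I" "\<And>i. i \<in> I \<Longrightarrow> c i \<in> orbit_cover N F k \<U>"
    and "\<And>X. X \<in> orbits N F k \<Longrightarrow> \<exists>i\<in>I. X \<in> c i"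
  shows "min_subcover_card N F k \<U> \<le> card I"
proof -
  have "c ` I \<in> finite_subcovers N F k \<U>"
    unfolding finite_subcovers_def
  proof (intro CollectI conjI equalityI)
    show "\<Union> (c ` I) \<subseteq> orbits N F k"
      using assms(2) by (force simp: orbit_cover_def)
  qed (use assms in auto)
  then have "min_subcover_card N F k \<U> \<le> card (c ` I)"
    unfolding min_subcover_card_def by (intro Least_le) blast
  also have "\<dots> \<le> card I" using assms(1) by (rule card_image_le)
  finally show ?thesis .
qed

text \<open>By compactness, finitely many sets of \<open>\<U>\<close> cover the sphere; the cells built from them are
  finitely many because a cell depends only on finitely many values of \<open>U\<close> and \<open>j\<close>.\<close>

lemma finite_subcovers_nonempty:
  assumes "open_cover \<U>"
  shows "finite_subcovers N F k \<U> \<noteq> {}"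
proof -
  obtain V where V: "V \<subseteq> \<U>" "finite V" "UNIV \<subseteq> \<Union>V"
    using assms compactE[OF compact_riemann_sphere, of \<U>] unfolding open_cover_def by auto
  define P where "P = ({0..k} \<rightarrow>\<^sub>E V) \<times> ({1..k} \<rightarrow>\<^sub>E {1..N})"
  define C where "C = (\<lambda>(U, j). orbit_cell N F k U j) ` P"
  have "\<forall>x. \<exists>U\<in>V. x \<in> U" using V(3) by blast
  then obtain G where G: "\<And>x. G x \<in> V" "\<And>x. x \<in> G x" by metis
  have "finite C"
    unfolding C_def P_def using V(2) by (intro finite_imageI finite_cartesian_product finite_PiE) auto
  moreover have "C \<subseteq> orbit_cover N F k \<U>"
    unfolding C_def P_def orbit_cover_eq_cells using V(1) by (fastforce simp: PiE_iff)
  moreover have "X \<in> \<Union>C" if X: "X \<in> orbits N F k" for X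
  proof -
    let ?U = "restrict (\<lambda>i. G (orbit_point i X)) {0..k}"
    let ?j = "restrict (\<lambda>i. orbit_index i X) {1..k}"
    have "(?U, ?j) \<in> P"
      using G(1) orbit_index_mem[OF X] by (auto simp: P_def PiE_iff)
    moreover have "X \<in> orbit_cell N F k ?U ?j"
      using X G(2) by (simp add: orbit_cell_def)
    ultimately show ?thesis unfolding C_def by force
  qed
  moreover have "\<Union>C \<subseteq> orbits N F k"
    by (auto simp: C_def orbit_cell_def)
  ultimately have "C \<in> finite_subcovers N F k \<U>"
    unfolding finite_subcovers_def by (intro CollectI conjI equalityI subsetI) auto
  then show ?thesis by blast
qed

lemma obtain_min_subcover:
  assumes "open_cover \<U>"
  obtains C where "C \<in> finite_subcovers N F k \<U>" "card C = min_subcover_card N F k \<U>"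
proof -
  have "\<exists>n. \<exists>C\<in>finite_subcovers N F k \<U>. card C = n"
    using finite_subcovers_nonempty[OF assms] by blast
  from LeastI_ex[OF this] show thesis
    using that unfolding min_subcover_card_def by blast
qed

lemma min_subcover_card_pos:
  assumes "open_cover \<U>" "orbits N F k \<noteq> {}"
  shows "0 < min_subcover_card N F k \<U>"
proof -
  obtain C where C: "C \<in> finite_subcovers N F k \<U>" "card C = min_subcover_card N F k \<U>"
    using obtain_min_subcover[OF assms(1)] .
  then have "C \<noteq> {}" "finite C" using assms(2) by (auto simp: finite_subcovers_def)
  then show ?thesis using C(2) by (metis card_gt_0_iff)
qed

section \<open>Growth of the subcover numbers\<close>

definition orbit_head :: "nat \<Rightarrow> orbit \<Rightarrow> orbit" where
  "orbit_head k X = (restrict (fst X) {0..k}, restrict (snd X) {1..k})"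

definition orbit_tail :: "nat \<Rightarrow> nat \<Rightarrow> orbit \<Rightarrow> orbit" where
  "orbit_tail k l X = (\<lambda>i\<in>{0..l}. fst X (k + i), \<lambda>i\<in>{1..l}. snd X (k + i))"

lemma orbit_head_mem:
  assumes "X \<in> orbits N F (k + l)"
  shows "orbit_head k X \<in> orbits N F k"
  using assms by (auto simp: orbits_def orbit_head_def PiE_iff)

lemma orbit_tail_mem:
  assumes "X \<in> orbits N F (k + l)"
  shows "orbit_tail k l X \<in> orbits N F l"
proof -
  obtain z \<alpha> where X: "X = (z, \<alpha>)" by (cases X)
  have \<alpha>: "\<alpha> i \<in> {1..N}" if "i \<in> {1..k + l}" for i
    using assms that by (auto simp: X orbits_def PiE_iff)
  have z: "(z (i - 1), z i) \<in> F (\<alpha> i)" if "i \<in> {1..k + l}" for i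
    using assms that by (auto simp: X orbits_def)
  have "(z (k + (r - 1)), z (k + r)) \<in> F (\<alpha> (k + r))" if "r \<in> {1..l}" for r
    using z[of "k + r"] that by simp
  moreover have "\<alpha> (k + r) \<in> {1..N}" if "r \<in> {1..l}" for r
    using \<alpha>[of "k + r"] that by simp
  ultimately show ?thesis
    by (auto simp: X orbits_def orbit_tail_def)
qed

text \<open>An orbit of length \<open>k + l\<close> is cut at time \<open>k\<close>. The two pieces share the point at time \<open>k\<close>,
  where both cells impose a condition; a member of the cover allows only one, so the condition
  coming from the second cell is dropped there.\<close>

lemma concatenated_cell:
  assumes "\<gamma> \<in> orbit_cover N F k \<U>" "\<gamma>' \<in> orbit_cover N F l \<U>"
  shows "\<exists>c\<in>orbit_cover N F (k + l) \<U>. \<forall>X\<in>orbits N F (k + l).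
           orbit_head k X \<in> \<gamma> \<longrightarrow> orbit_tail k l X \<in> \<gamma>' \<longrightarrow> X \<in> c"
proof -
  obtain U j where \<gamma>: "\<gamma> = orbit_cell N F k U j"
    and U: "\<forall>i\<in>{0..k}. U i \<in> \<U>" and j: "\<forall>i\<in>{1..k}. j i \<in> {1..N}"
    using assms(1) unfolding orbit_cover_eq_cells by blast
  obtain U' j' where \<gamma>': "\<gamma>' = orbit_cell N F l U' j'"
    and U': "\<forall>i\<in>{0..l}. U' i \<in> \<U>" and j': "\<forall>i\<in>{1..l}. j' i \<in> {1..N}"
    using assms(2) unfolding orbit_cover_eq_cells by blast
  define V where "V i = (if i \<le> k then U i else U' (i - k))" for i
  define v where "v i = (if i \<le> k then j i else j' (i - k))" for i
  have V: "\<forall>i\<in>{0..k + l}. V i \<in> \<U>" using U U' by (auto simp: V_def)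
  have v: "\<forall>i\<in>{1..k + l}. v i \<in> {1..N}"
  proof
    fix i assume i: "i \<in> {1..k + l}"
    then have "i \<le> k \<Longrightarrow> i \<in> {1..k}" "\<not> i \<le> k \<Longrightarrow> i - k \<in> {1..l}" by auto
    then show "v i \<in> {1..N}" using j j' unfolding v_def by presburger
  qed
  have "X \<in> orbit_cell N F (k + l) V v"
    if X: "X \<in> orbits N F (k + l)" "orbit_head k X \<in> \<gamma>" "orbit_tail k l X \<in> \<gamma>'" for X
  proof -
    have h: "\<forall>i\<in>{0..k}. fst X i \<in> U i" "\<forall>i\<in>{1..k}. snd X i = j i"
      using X(2) by (auto simp: \<gamma> orbit_cell_def orbit_head_def orbit_point_def orbit_index_def)
    have t: "\<forall>i\<in>{0..l}. fst X (k + i) \<in> U' i" "\<forall>i\<in>{1..l}. snd X (k + i) = j' i"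
      using X(3) by (auto simp: \<gamma>' orbit_cell_def orbit_tail_def orbit_point_def orbit_index_def)
    have "fst X i \<in> V i" if "i \<in> {0..k + l}" for i
      using that h(1) t(1)[rule_format, of "i - k"] by (auto simp: V_def)
    moreover have "snd X i = v i" if "i \<in> {1..k + l}" for i
    proof (cases "i \<le> k")
      case True
      then show ?thesis using that h(2) by (simp add: v_def)
    next
      case False
      then have "i - k \<in> {1..l}" "k + (i - k) = i" using that by auto
      then show ?thesis using t(2) False by (metis v_def)
    qed
    ultimately show ?thesis
      using X(1) by (simp add: orbit_cell_def orbit_point_def orbit_index_def)
  qed
  moreover have "orbit_cell N F (k + l) V v \<in> orbit_cover N F (k + l) \<U>"
    using V v unfolding orbit_cover_eq_cells by blast
  ultimately show ?thesis by blast
qed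

lemma min_subcover_card_submultiplicative:
  assumes "open_cover \<U>"
  shows "min_subcover_card N F (k + l) \<U> \<le> min_subcover_card N F k \<U> * min_subcover_card N F l \<U>"
proof -
  obtain C where C: "C \<in> finite_subcovers N F k \<U>" "card C = min_subcover_card N F k \<U>"
    using obtain_min_subcover[OF assms] .
  obtain C' where C': "C' \<in> finite_subcovers N F l \<U>" "card C' = min_subcover_card N F l \<U>"
    using obtain_min_subcover[OF assms] .
  have "\<forall>p\<in>C \<times> C'. \<exists>c. c \<in> orbit_cover N F (k + l) \<U> \<and> (\<forall>X\<in>orbits N F (k + l).
          orbit_head k X \<in> fst p \<longrightarrow> orbit_tail k l X \<in> snd p \<longrightarrow> X \<in> c)"
  proof
    fix p assume "p \<in> C \<times> C'"
    then have "fst p \<in> orbit_cover N F k \<U>" "snd p \<in> orbit_cover N F l \<U>"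
      using C(1) C'(1) by (auto simp: finite_subcovers_def)
    from concatenated_cell[OF this]
    show "\<exists>c. c \<in> orbit_cover N F (k + l) \<U> \<and> (\<forall>X\<in>orbits N F (k + l).
          orbit_head k X \<in> fst p \<longrightarrow> orbit_tail k l X \<in> snd p \<longrightarrow> X \<in> c)" by blast
  qed
  from bchoice[OF this] obtain c where
    c: "\<And>p. p \<in> C \<times> C' \<Longrightarrow> c p \<in> orbit_cover N F (k + l) \<U>" and
    Xc: "\<And>p X. p \<in> C \<times> C' \<Longrightarrow> X \<in> orbits N F (k + l) \<Longrightarrow> orbit_head k X \<in> fst p \<Longrightarrow>
           orbit_tail k l X \<in> snd p \<Longrightarrow> X \<in> c p"
    by metis
  have "min_subcover_card N F (k + l) \<U> \<le> card (C \<times> C')"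
  proof (rule min_subcover_card_le)
    show "finite (C \<times> C')" using C(1) C'(1) by (simp add: finite_subcovers_def)
  next
    fix X assume X: "X \<in> orbits N F (k + l)"
    obtain \<gamma> \<gamma>' where "\<gamma> \<in> C" "orbit_head k X \<in> \<gamma>" "\<gamma>' \<in> C'" "orbit_tail k l X \<in> \<gamma>'"
      using orbit_head_mem[OF X] orbit_tail_mem[OF X] C(1) C'(1)
      unfolding finite_subcovers_def by blast
    then show "\<exists>p\<in>C \<times> C'. X \<in> c p"
      using Xc[of "(\<gamma>, \<gamma>')" X] X by force
  qed (rule c)
  then show ?thesis by (simp add: card_cartesian_product C(2) C'(2))
qed

lemma min_subcover_card_growth_convergent:
  assumes "open_cover \<U>" and ne: "\<And>k. orbits N F k \<noteq> {}"
  shows "convergent (\<lambda>k. 1 / real k * ln (real (min_subcover_card N F k \<U>)))"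
proof -
  let ?n = "\<lambda>k. min_subcover_card N F k \<U>"
  have pos: "0 < ?n k" for k by (rule min_subcover_card_pos[OF assms(1) ne])
  have "ln (real (?n (k + l))) \<le> ln (real (?n k)) + ln (real (?n l))" for k l
  proof -
    have "real (?n (k + l)) \<le> real (?n k) * real (?n l)"
      using min_subcover_card_submultiplicative[OF assms(1), of N F k l]
      by (metis of_nat_le_iff of_nat_mult)
    then have "ln (real (?n (k + l))) \<le> ln (real (?n k) * real (?n l))"
      using pos by (subst ln_le_cancel_iff) auto
    then show ?thesis using pos by (simp add: ln_mult)
  qed
  moreover have "0 \<le> ln (real (?n k))" for k
    using pos[of k] by (intro ln_ge_zero) simp
  ultimately have "convergent (\<lambda>k. ln (real (?n k)) / real k)"
    by (rule subadditive_convergent)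
  then show ?thesis by simp
qed

text \<open>Each nonempty member of a subcover contributes \<open>1\<close>. Empty members contribute \<open>0\<close> but are counted
  by \<open>card\<close>; a minimal subcover has none, because discarding them leaves a subcover.\<close>

lemma cover_sum_zero:
  assumes "open_cover \<U>"
  shows "cover_sum N F k (\<lambda>_. 0) \<U> = of_nat (min_subcover_card N F k \<U>)"
proof -
  let ?s = "\<lambda>C. \<Sum>\<gamma>\<in>C. SUP X\<in>\<gamma>. ennreal (orbit_weight k (\<lambda>_. 0) X)"
  have s: "?s C = of_nat (card {\<gamma> \<in> C. \<gamma> \<noteq> {}})" if "finite C" for C
  proof -
    have "?s C = (\<Sum>\<gamma>\<in>C. if \<gamma> \<noteq> {} then 1 else 0)"
      by (intro sum.cong) (auto simp: orbit_weight_def bot_ennreal)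
    also have "\<dots> = of_nat (card {\<gamma> \<in> C. \<gamma> \<noteq> {}})"
      using that by (simp add: sum.If_cases Int_def)
    finally show ?thesis .
  qed
  show ?thesis
    unfolding cover_sum_def
  proof (rule antisym)
    obtain C where C: "C \<in> finite_subcovers N F k \<U>" "card C = min_subcover_card N F k \<U>"
      using obtain_min_subcover[OF assms] .
    have fin: "finite C" using C(1) by (simp add: finite_subcovers_def)
    have "(INF C\<in>finite_subcovers N F k \<U>. ?s C) \<le> ?s C"
      by (rule INF_lower[OF C(1)])
    also have "\<dots> \<le> of_nat (card C)"
      unfolding s[OF fin] using fin by (intro of_nat_mono card_mono) auto
    finally show "(INF C\<in>finite_subcovers N F k \<U>. ?s C) \<le> of_nat (min_subcover_card N F k \<U>)"
      by (simp only: C(2))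
  next
    show "of_nat (min_subcover_card N F k \<U>) \<le> (INF C\<in>finite_subcovers N F k \<U>. ?s C)"
    proof (rule INF_greatest)
      fix C assume C: "C \<in> finite_subcovers N F k \<U>"
      then have fin: "finite C" by (simp add: finite_subcovers_def)
      have "{\<gamma> \<in> C. \<gamma> \<noteq> {}} \<in> finite_subcovers N F k \<U>"
        using C by (auto simp: finite_subcovers_def)
      then have "min_subcover_card N F k \<U> \<le> card {\<gamma> \<in> C. \<gamma> \<noteq> {}}"
        unfolding min_subcover_card_def by (intro Least_le) blast
      then show "of_nat (min_subcover_card N F k \<U>) \<le> ?s C"
        unfolding s[OF fin] by (rule of_nat_mono)
    qed
  qed
qed

lemma log_ennreal_of_nat:
  assumes "0 < n"
  shows "log_ennreal (of_nat n) = ereal (ln (real n))"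
  using assms by (simp add: log_ennreal_def ennreal_of_nat_eq_real_of_nat)

section \<open>Separated sets against covers\<close>

text \<open>Two orbits in the same cell have the same indices and stay within \<open>cover_diameter \<U>\<close> of each
  other, so a cell contains at most one orbit of a separated set.\<close>

lemma card_separated_le:
  assumes "open_cover \<U>" "cover_diameter \<U> \<le> \<epsilon>" "separated N F k \<epsilon> Y"
  shows "finite Y \<and> card Y \<le> min_subcover_card N F k \<U>"
proof -
  obtain C where C: "C \<in> finite_subcovers N F k \<U>" "card C = min_subcover_card N F k \<U>"
    using obtain_min_subcover[OF assms(1)] .
  have "\<forall>X\<in>Y. \<exists>\<gamma>. \<gamma> \<in> C \<and> X \<in> \<gamma>"
    using C(1) assms(3) by (auto simp: finite_subcovers_def separated_def)
  then obtain c where c: "\<And>X. X \<in> Y \<Longrightarrow> c X \<in> C" "\<And>X. X \<in> Y \<Longrightarrow> X \<in> c X" by metis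
  have "inj_on c Y"
  proof (rule inj_onI, rule ccontr)
    fix X X' assume X: "X \<in> Y" "X' \<in> Y" "c X = c X'" "X \<noteq> X'"
    obtain U j where cell: "c X = orbit_cell N F k U j" and U: "\<forall>i\<in>{0..k}. U i \<in> \<U>"
      using c(1)[OF X(1)] C(1) unfolding finite_subcovers_def orbit_cover_eq_cells by blast
    have "X \<in> orbit_cell N F k U j" "X' \<in> orbit_cell N F k U j"
      using c(2)[OF X(1)] c(2)[OF X(2)] X(3) cell by simp_all
    then have mem: "\<forall>i\<in>{0..k}. orbit_point i X \<in> U i \<and> orbit_point i X' \<in> U i"
      and index: "\<forall>i\<in>{1..k}. orbit_index i X = orbit_index i X'"
      by (simp_all add: orbit_cell_def)
    have "dist (orbit_point i X) (orbit_point i X') \<le> \<epsilon>" if "i \<in> {0..k}" for i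
      using mem U that dist_le_cover_diameter[of "U i" \<U>] assms(2) by (meson order.trans)
    then show False
      using assms(3) X(1,2,4) index unfolding separated_def by (meson not_le)
  qed
  moreover have "c ` Y \<subseteq> C" "finite C" using c(1) C(1) by (auto simp: finite_subcovers_def)
  ultimately show ?thesis
    using C(2) by (metis card_inj_on_le inj_on_finite)
qed

lemma infsum_weight_zero:
  assumes "finite Y"
  shows "(\<Sum>\<^sub>\<infinity>X\<in>Y. ennreal (orbit_weight k (\<lambda>_. 0) X)) = of_nat (card Y)"
  using assms by (simp add: orbit_weight_def)

lemma separated_sum_le_min_subcover_card:
  assumes "open_cover \<U>" "cover_diameter \<U> \<le> \<epsilon>"
  shows "separated_sum N F k (\<lambda>_. 0) \<epsilon> \<le> of_nat (min_subcover_card N F k \<U>)"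
  unfolding separated_sum_def
proof (rule SUP_least)
  fix Y assume "Y \<in> {Y. separated N F k \<epsilon> Y}"
  then have "finite Y" "card Y \<le> min_subcover_card N F k \<U>"
    using card_separated_le[OF assms] by auto
  then show "(\<Sum>\<^sub>\<infinity>X\<in>Y. ennreal (orbit_weight k (\<lambda>_. 0) X)) \<le> of_nat (min_subcover_card N F k \<U>)"
    by (simp only: infsum_weight_zero of_nat_mono)
qed

text \<open>Cardinalities of separated sets are bounded by a subcover number, so one of them is
  largest. By maximality no orbit can be added to it.\<close>

lemma ex_spanning_separated:
  assumes "0 < \<epsilon>"
  shows "\<exists>Y. finite Y \<and> separated N F k \<epsilon> Y \<and> (\<forall>X\<in>orbits N F k. \<exists>X'\<in>Y.
       (\<forall>i\<in>{0..k}. dist (orbit_point i X') (orbit_point i X) \<le> \<epsilon>) \<and>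
       (\<forall>i\<in>{1..k}. orbit_index i X' = orbit_index i X))"
proof -
  obtain \<U> where \<U>: "open_cover \<U>" "cover_diameter \<U> \<le> \<epsilon>"
    using ex_fine_open_cover[OF assms] by blast
  define P where "P n \<longleftrightarrow> (\<exists>Y. separated N F k \<epsilon> Y \<and> card Y = n)" for n
  have bound: "n \<le> min_subcover_card N F k \<U>" if "P n" for n
    using that card_separated_le[OF \<U>] by (auto simp: P_def)
  have "P 0" unfolding P_def by (rule exI[of _ "{}"]) (simp add: separated_def)
  then have "P (Greatest P)" using bound by (rule GreatestI_nat)
  then obtain Y where Y: "separated N F k \<epsilon> Y" "card Y = Greatest P"
    by (auto simp: P_def)
  have fin: "finite Y" using card_separated_le[OF \<U> Y(1)] by simp
  show ?thesis
  proof (intro exI[of _ Y] conjI ballI fin Y(1), rule ccontr)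
    fix X assume X: "X \<in> orbits N F k"
      and far: "\<not> (\<exists>X'\<in>Y. (\<forall>i\<in>{0..k}. dist (orbit_point i X') (orbit_point i X) \<le> \<epsilon>) \<and>
                 (\<forall>i\<in>{1..k}. orbit_index i X' = orbit_index i X))"
    then have "X \<notin> Y" using assms by force
    have "separated N F k \<epsilon> (insert X Y)"
      unfolding separated_def
    proof (intro conjI ballI impI)
      show "insert X Y \<subseteq> orbits N F k" using X Y(1) by (simp add: separated_def)
    next
      fix A B assume AB: "A \<in> insert X Y" "B \<in> insert X Y" "A \<noteq> B"
      have far': "(\<exists>i\<in>{0..k}. \<epsilon> < dist (orbit_point i Z) (orbit_point i X)) \<or>
          (\<exists>i\<in>{1..k}. orbit_index i Z \<noteq> orbit_index i X)" if "Z \<in> Y" for Z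
        using far that by (meson not_le)
      consider "A \<in> Y" "B \<in> Y" | "A = X" "B \<in> Y" | "B = X" "A \<in> Y" using AB by blast
      then show "(\<exists>i\<in>{0..k}. \<epsilon> < dist (orbit_point i A) (orbit_point i B)) \<or>
          (\<exists>i\<in>{1..k}. orbit_index i A \<noteq> orbit_index i B)"
      proof cases
        case 1
        then show ?thesis using Y(1) AB(3) by (simp add: separated_def)
      next
        case 2
        then show ?thesis using far'[of B] by (metis dist_commute)
      next
        case 3
        then show ?thesis using far'[of A] by simp
      qed
    qed
    then have "P (Suc (card Y))"
      unfolding P_def using fin \<open>X \<notin> Y\<close> by (intro exI[of _ "insert X Y"]) simp
    then have "Suc (card Y) \<le> Greatest P" using bound by (rule Greatest_le_nat)
    then show False using Y(2) by simp
  qed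
qed

text \<open>The cells that follow the orbits of a maximal separated set, each point being enclosed with its
  \<open>\<epsilon>\<close>-ball in a member of \<open>\<U>\<close>, form a subcover.\<close>

lemma min_subcover_card_le_separated_sum:
  assumes "0 < \<epsilon>" and lebesgue: "\<And>x. \<exists>U\<in>\<U>. cball x \<epsilon> \<subseteq> U"
  shows "of_nat (min_subcover_card N F k \<U>) \<le> separated_sum N F k (\<lambda>_. 0) \<epsilon>"
proof -
  obtain Y where fin: "finite Y" and Y: "separated N F k \<epsilon> Y" and
    span: "\<forall>X\<in>orbits N F k. \<exists>X'\<in>Y.
       (\<forall>i\<in>{0..k}. dist (orbit_point i X') (orbit_point i X) \<le> \<epsilon>) \<and>
       (\<forall>i\<in>{1..k}. orbit_index i X' = orbit_index i X)"
    using ex_spanning_separated[OF assms(1), of N F k] by (elim exE conjE) (rule that)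
  obtain G where G: "\<And>x. G x \<in> \<U>" "\<And>x. cball x \<epsilon> \<subseteq> G x" using lebesgue by metis
  have "min_subcover_card N F k \<U> \<le> card Y"
  proof (rule min_subcover_card_le[OF fin])
    fix X assume "X \<in> Y"
    then have "X \<in> orbits N F k" using Y by (auto simp: separated_def)
    then show "orbit_cell N F k (\<lambda>i. G (orbit_point i X)) (\<lambda>i. orbit_index i X) \<in> orbit_cover N F k \<U>"
      unfolding orbit_cover_eq_cells using G(1) orbit_index_mem by blast
  next
    fix X assume X: "X \<in> orbits N F k"
    obtain X' where X': "X' \<in> Y" "\<forall>i\<in>{0..k}. dist (orbit_point i X') (orbit_point i X) \<le> \<epsilon>"
      "\<forall>i\<in>{1..k}. orbit_index i X' = orbit_index i X"
      using span X by blast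
    have "orbit_point i X \<in> G (orbit_point i X')" if "i \<in> {0..k}" for i
      using G(2)[of "orbit_point i X'"] X'(2) that by (auto simp: subset_iff)
    then have "X \<in> orbit_cell N F k (\<lambda>i. G (orbit_point i X')) (\<lambda>i. orbit_index i X')"
      using X X'(3) by (simp add: orbit_cell_def)
    with X'(1) show "\<exists>X'\<in>Y. X \<in> orbit_cell N F k (\<lambda>i. G (orbit_point i X')) (\<lambda>i. orbit_index i X')"
      by blast
  qed
  then have "of_nat (min_subcover_card N F k \<U>) \<le> (of_nat (card Y) :: ennreal)"
    by (rule of_nat_mono)
  also have "\<dots> = (\<Sum>\<^sub>\<infinity>X\<in>Y. ennreal (orbit_weight k (\<lambda>_. 0) X))"
    by (rule infsum_weight_zero[OF fin, symmetric])
  also have "\<dots> \<le> separated_sum N F k (\<lambda>_. 0) \<epsilon>"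
    unfolding separated_sum_def using Y by (intro SUP_upper) simp
  finally show ?thesis .
qed

section \<open>Entropy\<close>

definition separated_growth ::
  "nat \<Rightarrow> (nat \<Rightarrow> (riemann_sphere \<times> riemann_sphere) set) \<Rightarrow> real \<Rightarrow> ereal" where
  "separated_growth N F \<epsilon> =
     limsup (\<lambda>k. ereal (1 / real k) * log_ennreal (separated_sum N F k (\<lambda>_. 0) \<epsilon>))"

definition cover_growth ::
  "nat \<Rightarrow> (nat \<Rightarrow> (riemann_sphere \<times> riemann_sphere) set) \<Rightarrow> riemann_sphere set set \<Rightarrow> ereal" where
  "cover_growth N F \<U> = lim (\<lambda>k. ereal (1 / real k * ln (real (min_subcover_card N F k \<U>))))"

lemma separated_growth_le_entropy:
  assumes "0 < \<epsilon>"
  shows "separated_growth N F \<epsilon> \<le> topological_entropy N F"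
proof (rule tendsto_lowerbound)
  show "(separated_growth N F \<longlongrightarrow> topological_entropy N F) (at_right 0)"
    using pressure_limit[of N F "\<lambda>_. 0"] unfolding topological_entropy_def separated_growth_def .
  have "separated_growth N F \<epsilon> \<le> separated_growth N F \<epsilon>'" if "\<epsilon>' \<le> \<epsilon>" for \<epsilon>'
    unfolding separated_growth_def using that
    by (intro Limsup_mono always_eventually allI ereal_mult_left_mono log_ennreal_mono
        separated_sum_antimono) auto
  then show "\<forall>\<^sub>F \<epsilon>' in at_right 0. separated_growth N F \<epsilon> \<le> separated_growth N F \<epsilon>'"
    using assms unfolding eventually_at_right_field by (metis less_imp_le)
qed simp

lemma cover_growth_eq:
  assumes "open_cover \<U>" and "\<And>k. orbits N F k \<noteq> {}"
  shows "(\<lambda>k. ereal (1 / real k) * log_ennreal (of_nat (min_subcover_card N F k \<U>))) =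
         (\<lambda>k. ereal (1 / real k * ln (real (min_subcover_card N F k \<U>))))"
  using log_ennreal_of_nat[OF min_subcover_card_pos[OF assms]] by auto

lemma cover_growth_convergent:
  assumes "open_cover \<U>" and "\<And>k. orbits N F k \<noteq> {}"
  shows "convergent (\<lambda>k. ereal (1 / real k * ln (real (min_subcover_card N F k \<U>))))"
  using min_subcover_card_growth_convergent[OF assms]
  by (auto simp: convergent_def intro: tendsto_ereal)

lemma cover_growth_limsup:
  assumes "open_cover \<U>" and "\<And>k. orbits N F k \<noteq> {}"
  shows "cover_growth N F \<U> =
    limsup (\<lambda>k. ereal (1 / real k) * log_ennreal (of_nat (min_subcover_card N F k \<U>)))"
  unfolding cover_growth_def cover_growth_eq[OF assms]
  using convergent_LIMSEQ_iff[THEN iffD1, OF cover_growth_convergent[OF assms]]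
  by (intro lim_imp_Limsup[symmetric]) auto

lemma separated_growth_le_cover_growth:
  assumes "open_cover \<U>" "cover_diameter \<U> \<le> \<epsilon>" and "\<And>k. orbits N F k \<noteq> {}"
  shows "separated_growth N F \<epsilon> \<le> cover_growth N F \<U>"
  unfolding separated_growth_def cover_growth_limsup[OF assms(1,3)]
  using separated_sum_le_min_subcover_card[OF assms(1,2)]
  by (intro Limsup_mono always_eventually allI ereal_mult_left_mono log_ennreal_mono) auto

text \<open>The Lebesgue number of the cover supplies the scale at which separated sets dominate the
  subcover numbers, uniformly in \<open>k\<close>.\<close>

lemma cover_growth_le_entropy:
  assumes "open_cover \<U>" and "\<And>k. orbits N F k \<noteq> {}"
  shows "cover_growth N F \<U> \<le> topological_entropy N F"
proof -
  obtain e where e: "0 < e" "\<And>x. \<exists>U\<in>\<U>. ball x e \<subseteq> U"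
    using Heine_Borel_lemma[OF compact_riemann_sphere, of \<U>] assms(1)
    unfolding open_cover_def by (metis UNIV_I subset_UNIV)
  \<comment> \<open>Orbits that are not separated may be at distance exactly \<open>\<epsilon>\<close>, so closed balls are needed.\<close>
  have "cball x (e / 2) \<subseteq> ball x e" for x :: riemann_sphere using e(1) by auto
  then have "\<exists>U\<in>\<U>. cball x (e / 2) \<subseteq> U" for x using e(2)[of x] by (meson order.trans)
  then have "of_nat (min_subcover_card N F k \<U>) \<le> separated_sum N F k (\<lambda>_. 0) (e / 2)" for k
    using e(1) by (intro min_subcover_card_le_separated_sum) auto
  then have "cover_growth N F \<U> \<le> separated_growth N F (e / 2)"
    unfolding separated_growth_def cover_growth_limsup[OF assms]
    by (intro Limsup_mono always_eventually allI ereal_mult_left_mono log_ennreal_mono) auto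
  also have "\<dots> \<le> topological_entropy N F"
    using e(1) by (intro separated_growth_le_entropy) simp
  finally show ?thesis .
qed

lemma SUP_cover_growth_tendsto_entropy:
  assumes ne: "\<And>k. orbits N F k \<noteq> {}"
  shows "((\<lambda>\<delta>. SUP \<U>\<in>{\<U>. open_cover \<U> \<and> cover_diameter \<U> \<le> \<delta>}. cover_growth N F \<U>)
           \<longlongrightarrow> topological_entropy N F) (at_right 0)"
proof (rule tendsto_sandwich)
  show "(separated_growth N F \<longlongrightarrow> topological_entropy N F) (at_right 0)"
    using pressure_limit[of N F "\<lambda>_. 0"] unfolding topological_entropy_def separated_growth_def .
  have "separated_growth N F \<delta> \<le>
      (SUP \<U>\<in>{\<U>. open_cover \<U> \<and> cover_diameter \<U> \<le> \<delta>}. cover_growth N F \<U>)" if \<delta>: "0 < \<delta>" for \<delta>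
  proof -
    obtain \<U> where "open_cover \<U>" "cover_diameter \<U> \<le> \<delta>"
      using ex_fine_open_cover[OF \<delta>] by blast
    then show ?thesis
      using separated_growth_le_cover_growth[OF _ _ ne] by (intro SUP_upper2[of \<U>]) auto
  qed
  then show "\<forall>\<^sub>F \<delta> in at_right 0. separated_growth N F \<delta> \<le>
      (SUP \<U>\<in>{\<U>. open_cover \<U> \<and> cover_diameter \<U> \<le> \<delta>}. cover_growth N F \<U>)"
    by (simp add: eventually_at_filter)
  show "\<forall>\<^sub>F \<delta> in at_right 0. (SUP \<U>\<in>{\<U>. open_cover \<U> \<and> cover_diameter \<U> \<le> \<delta>}. cover_growth N F \<U>)
      \<le> topological_entropy N F"
    using cover_growth_le_entropy[OF _ ne] by (intro always_eventually allI SUP_least) auto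
qed (rule tendsto_const)

theorem corollary3p5:
  fixes N :: nat and F :: "nat \<Rightarrow> (riemann_sphere \<times> riemann_sphere) set"
  assumes "holomorphic_correspondence N F"
  shows "(\<forall>\<U>. open_cover \<U> \<longrightarrow>
             convergent (\<lambda>k. ereal (1 / real k) * log_ennreal (cover_sum N F k (\<lambda>_. 0) \<U>)))
       \<and> ((\<lambda>\<delta>. SUP \<U>\<in>{\<U>. open_cover \<U> \<and> cover_diameter \<U> \<le> \<delta>}.
              lim (\<lambda>k. ereal (1 / real k) * log_ennreal (cover_sum N F k (\<lambda>_. 0) \<U>)))
            \<longlongrightarrow> topological_entropy N F) (at_right 0)
       \<and> (\<forall>\<U>. open_cover \<U> \<longrightarrow>
             convergent (\<lambda>k. ereal (1 / real k * ln (real (min_subcover_card N F k \<U>)))))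
       \<and> ((\<lambda>\<delta>. SUP \<U>\<in>{\<U>. open_cover \<U> \<and> cover_diameter \<U> \<le> \<delta>}.
              lim (\<lambda>k. ereal (1 / real k * ln (real (min_subcover_card N F k \<U>)))))
            \<longlongrightarrow> topological_entropy N F) (at_right 0)"
proof -
  have ne: "orbits N F k \<noteq> {}" for k
    using assms by (intro orbits_nonempty) (auto simp: holomorphic_correspondence_def)
  have eq: "(\<lambda>k. ereal (1 / real k) * log_ennreal (cover_sum N F k (\<lambda>_. 0) \<U>)) =
      (\<lambda>k. ereal (1 / real k * ln (real (min_subcover_card N F k \<U>))))" if "open_cover \<U>" for \<U>
    using cover_growth_eq[OF that ne] by (simp only: cover_sum_zero[OF that])
  have SUP_eq: "(SUP \<U>\<in>{\<U>. open_cover \<U> \<and> cover_diameter \<U> \<le> \<delta>}.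
        lim (\<lambda>k. ereal (1 / real k) * log_ennreal (cover_sum N F k (\<lambda>_. 0) \<U>))) =
      (SUP \<U>\<in>{\<U>. open_cover \<U> \<and> cover_diameter \<U> \<le> \<delta>}. cover_growth N F \<U>)" for \<delta>
    by (intro SUP_cong) (auto simp: eq cover_growth_def)
  show ?thesis
    using cover_growth_convergent[OF _ ne] SUP_cover_growth_tendsto_entropy[OF ne]
    unfolding SUP_eq by (simp add: eq cover_growth_def)
qed

end
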